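(* Let $N_1,N_2\ge 1$ be integers, $N=N_1+N_2$, and let $\mu=(\mu_{ij})_{i,j\in\{1,2\}}$ be a matrix of positive real numbers. For states $\mathcal S=(N_{11},N_{22})\in\{0,\dots,N_1\}\times\{0,\dots,N_2\}$ let $X(\mathcal S)$ be the state throughput defined in the context, and for a policy with state probabilities $p$ let $X_{sys}=\sum_{\mathcal S}p(\mathcal S)X(\mathcal S)$. Then the maximum of $X_{sys}$ over all policies is achieved by a policy that keeps the system at all times in a state $\mathcal S_{max}$ (i.e. $p(\mathcal S_{max})=1$) maximizing $X(\mathcal S)$ over all states, where $\mathcal S_{max}$ is determined by the order relations among the entries of $\mu$ as follows: (i) (Homogeneous) if $\mu_{11}=\mu_{22}=\mu_{12}=\mu_{21}$, then $\mathcal S_{max}$ can be any state $(N_{11},N_{22})$ with $-N_1<N_{22}-N_{11}<N_2$; (ii) (big.LITTLE-like) if $\mu_{11}=\mu_{21}$, $\mu_{22}=\mu_{12}$ and $\mu_{11}\neq\mu_{22}$, then $\mathcal S_{max}$ can be any state $(N_{11},N_{22})$ with $-N_1<N_{22}-N_{11}<N_2$; (iii) (Symmetric) if $\mu_{11}=\mu_{22}$, $\mu_{12}=\mu_{21}$ and $\mu_{11}>\mu_{12}$, then $\mathcal S_{max}=(N_1,N_2)$; (iv) (General-symmetric) if $\mu_{11}>\mu_{12}$, $\mu_{21}<\mu_{22}$, $\mu_{11}>\mu_{21}$ and $\mu_{12}<\mu_{22}$, then $\mathcal S_{max}=(N_1,N_2)$; (v) (P1-biased) if $\mu_{11}>\mu_{12}$,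 $\mu_{21}<\mu_{22}$, $\mu_{11}>\mu_{21}$ and $\mu_{12}>\mu_{22}$, then $\mathcal S_{max}=(1,N_2)$; (vi) (P2-biased) if $\mu_{11}>\mu_{12}$, $\mu_{21}<\mu_{22}$, $\mu_{11}<\mu_{21}$ and $\mu_{12}<\mu_{22}$, then $\mathcal S_{max}=(N_1,1)$.
   Context: A closed system has two processors and always contains exactly $N=N_1+N_2$ tasks, $N_i$ of type $i$ ($i=1,2$). $\mu_{ij}>0$ is the processing rate of an $i$-type task on processor $j$. $N_{ij}$ is the number of $i$-type tasks on processor $j$, so $N_{12}=N_1-N_{11}$ and $N_{21}=N_2-N_{22}$; a state is a pair $\mathcal S=(N_{11},N_{22})$ with $N_{11}\in\{0,\dots,N_1\}$, $N_{22}\in\{0,\dots,N_2\}$. The throughput of a state is $$X(N_{11},N_{22})=\frac{\mu_{11}N_{11}+\mu_{21}(N_2-N_{22})}{N_{11}+N_2-N_{22}}+\frac{\mu_{22}N_{22}+\mu_{12}(N_1-N_{11})}{N_{22}+N_1-N_{11}},$$ where a term whose denominator is zero (an empty processor) is taken to be $0$. A scheduling policy induces state probabilities $p(\mathcal S)\ge 0$ with $\sum_{\mathcal S}p(\mathcal S)=1$ (any such probability vector is allowed as a competitor), and its system throughput is $X_{sys}=\sum_{\mathcal S}p(\mathcal S)X(\mathcal S)$. *)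

theory Defs
  imports "HOL-Analysis.Analysis"
begin

text \<open>
  The rate matrix is \<open>\<mu> :: real^2^2\<close>, where \<open>\<mu> $ i $ j\<close> is the rate of a type-\<open>i\<close> task on
  processor \<open>j\<close>. A state is the pair \<open>(N11, N22)\<close>.
\<close>

definition states :: "nat \<Rightarrow> nat \<Rightarrow> (nat \<times> nat) set" where
  "states N1 N2 = {0..N1} \<times> {0..N2}"

text \<open>
  The first summand belongs to processor 1 and the second to processor 2. On states, a denominator
  vanishes exactly when that processor is empty, and then \<open>x / 0 = 0\<close> gives the intended value.
\<close>

definition throughput :: "nat \<Rightarrow> nat \<Rightarrow> real^2^2 \<Rightarrow> nat \<times> nat \<Rightarrow> real" where
  "throughput N1 N2 \<mu> = (\<lambda>(N11, N22).
     (\<mu> $ 1 $ 1 * real N11 + \<mu> $ 2 $ 1 * (real N2 - real N22)) / (real N11 + real N2 - real N22)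
   + (\<mu> $ 2 $ 2 * real N22 + \<mu> $ 1 $ 2 * (real N1 - real N11)) / (real N22 + real N1 - real N11))"

text \<open>A policy is represented by its state probabilities; values outside \<open>states\<close> are irrelevant.\<close>

definition policy :: "nat \<Rightarrow> nat \<Rightarrow> (nat \<times> nat \<Rightarrow> real) \<Rightarrow> bool" where
  "policy N1 N2 p \<longleftrightarrow> (\<forall>S\<in>states N1 N2. p S \<ge> 0) \<and> (\<Sum>S\<in>states N1 N2. p S) = 1"

definition sys_throughput :: "nat \<Rightarrow> nat \<Rightarrow> real^2^2 \<Rightarrow> (nat \<times> nat \<Rightarrow> real) \<Rightarrow> real" where
  "sys_throughput N1 N2 \<mu> p = (\<Sum>S\<in>states N1 N2. p S * throughput N1 N2 \<mu> S)"

definition max_state :: "nat \<Rightarrow> nat \<Rightarrow> real^2^2 \<Rightarrow> nat \<times> nat \<Rightarrow> bool" where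
  "max_state N1 N2 \<mu> S \<longleftrightarrow> is_arg_max (throughput N1 N2 \<mu>) (\<lambda>T. T \<in> states N1 N2) S"

definition optimal_policy :: "nat \<Rightarrow> nat \<Rightarrow> real^2^2 \<Rightarrow> (nat \<times> nat \<Rightarrow> real) \<Rightarrow> bool" where
  "optimal_policy N1 N2 \<mu> p \<longleftrightarrow> is_arg_max (sys_throughput N1 N2 \<mu>) (policy N1 N2) p"

end

theory Submission
  imports Defs
begin

text \<open>
  A policy averages the state throughputs, so it is optimal as soon as it is concentrated on a best
  state. The throughput of a state is the sum over the two processors of the mean rate of the tasks
  they hold. Outside the biased cases both mean rates are maximal at once. In the P1-biased case,
  let processor 1 hold \<open>s > 0\<close> tasks, \<open>d\<close> of them of type 2, and processor 2 hold \<open>t > 0\<close> tasks, \<open>b\<close> of them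
  of type 2. The throughput is \<open>\<mu>\<^sub>1\<^sub>1 + \<mu>\<^sub>1\<^sub>2 - (\<mu>\<^sub>1\<^sub>1 - \<mu>\<^sub>2\<^sub>1) d/s - (\<mu>\<^sub>1\<^sub>2 - \<mu>\<^sub>2\<^sub>2) b/t\<close>. The first
  coefficient is the larger one, and \<open>s, t \<le> s + t - 1\<close>, so the total loss is at least
  \<open>(\<mu>\<^sub>1\<^sub>2 - \<mu>\<^sub>2\<^sub>2) (d + b) / (s + t - 1)\<close>, the loss of the state \<open>(1, N\<^sub>2)\<close>. The P2-biased case
  follows by exchanging the two types together with the two processors.
\<close>

text \<open>The rates are plain arguments, so exchanging types and processors is just a renaming. An
  empty processor gets the value 0 because \<open>x / 0 = 0\<close>.\<close>

definition mean_rate :: "real \<Rightarrow> real \<Rightarrow> real \<Rightarrow> real \<Rightarrow> real" where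
  "mean_rate u v x y = (u * x + v * y) / (x + y)"

lemma throughput_eq_mean_rates:
  "throughput N1 N2 \<mu> (a, b) =
     mean_rate (\<mu> $ 1 $ 1) (\<mu> $ 2 $ 1) (real a) (real N2 - real b)
   + mean_rate (\<mu> $ 2 $ 2) (\<mu> $ 1 $ 2) (real b) (real N1 - real a)"
  by (simp add: throughput_def mean_rate_def add_diff_eq)

lemma mean_rate_eq: "x + y \<noteq> 0 \<Longrightarrow> mean_rate u v x y = u - (u - v) * (y / (x + y))"
  by (simp add: mean_rate_def field_simps)

lemma mean_rate_commute: "mean_rate u v x y = mean_rate v u y x"
  by (simp add: mean_rate_def add.commute)

lemma mean_rate_same: "x + y \<noteq> 0 \<Longrightarrow> mean_rate u u x y = u"
  by (simp add: mean_rate_eq)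

lemma mean_rate_no_second: "x \<noteq> 0 \<Longrightarrow> mean_rate u v x 0 = u"
  by (simp add: mean_rate_def)

text \<open>The loss term of \<open>mean_rate_eq\<close> is nonnegative; \<open>0 \<le> u\<close>
  handles the empty processor, whose mean rate is 0.\<close>

lemma mean_rate_le:
  assumes "v \<le> u" "0 \<le> u" "0 \<le> x" "0 \<le> y"
  shows "mean_rate u v x y \<le> u"
proof (cases "x + y = 0")
  case True
  then show ?thesis using assms by (simp add: mean_rate_def)
next
  case False
  then show ?thesis using assms by (simp add: mean_rate_eq)
qed

lemma mean_rate_less:
  assumes "v < u" "0 \<le> x" "0 < y"
  shows "mean_rate u v x y < u"
  using assms by (simp add: mean_rate_eq)

lemma mean_rate_pos:
  assumes "0 < u" "0 < v" "0 \<le> x" "0 \<le> y" "0 < x + y"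
  shows "0 < mean_rate u v x y"
proof -
  have "0 < u * x + v * y"
    using assms by (cases "x = 0") (auto intro: add_pos_nonneg)
  then show ?thesis using assms by (simp add: mean_rate_def)
qed

text \<open>Here \<open>m\<close>, \<open>n\<close> stand for \<open>N1\<close>, \<open>N2\<close>.
  The right-hand side is the throughput of \<open>(1, n)\<close>, whose processor 1 holds a single
  type-1 task and so contributes exactly \<open>u11\<close>.\<close>

lemma p1_biased_strict_max:
  fixes m n a b :: nat
  assumes mu: "u12 < u11" "u22 < u12" "u21 < u22" "0 < u21"
    and mn: "1 \<le> m" "1 \<le> n" "a \<le> m" "b \<le> n" and ne: "(a, b) \<noteq> (1, n)"
  shows "mean_rate u11 u21 (real a) (real n - real b) + mean_rate u22 u12 (real b) (real m - real a)
       < u11 + mean_rate u22 u12 (real n) (real m - 1)"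
proof -
  define d s t where "d = real n - real b" and "s = real a + d" and "t = real b + (real m - real a)"
  have d0: "0 \<le> d" using mn by (simp add: d_def)
  have pos: "0 < mean_rate u22 u12 (real n) (real m - 1)"
    using mu mn by (intro mean_rate_pos) auto
  have le1: "mean_rate u11 u21 (real a) (real n - real b) \<le> u11"
    and le2: "mean_rate u12 u22 (real m - real a) (real b) \<le> u12"
    using mu mn by (auto intro!: mean_rate_le)
  \<comment> \<open>Processor 1 is empty only at \<open>(0, n)\<close> and processor 2 only at
    \<open>(m, 0)\<close>. Otherwise both hold at least one task, and the loss formula applies to
    each.\<close>
  consider "a = 0" "b = n" | "a = m" "b = 0" | "1 \<le> s" "1 \<le> t"
    using mn unfolding s_def t_def d_def by linarith
  then show ?thesis
  proof cases
    \<comment> \<open>With one processor empty, the other alone yields at most \<open>u11\<close>,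
      while \<open>(1, n)\<close> adds a positive rate to \<open>u11\<close>.\<close>
    case 1
    then have "mean_rate u11 u21 (real a) (real n - real b) = 0"
      by (simp add: mean_rate_def)
    moreover have "mean_rate u22 u12 (real b) (real m - real a) \<le> u12"
      using le2 by (subst mean_rate_commute)
    ultimately show ?thesis using pos mu by linarith
  next
    case 2
    then show ?thesis
      using le1 pos by (simp add: mean_rate_def[of u22 u12 0 0])
  next
    case 3
    define D E where "D = u11 - u21" and "E = u12 - u22"
    have E: "0 < E" "E < D" using mu by (auto simp: D_def E_def)
    have st: "s + t = real n + real m" by (simp add: s_def t_def d_def)
    \<comment> \<open>Strictness has two sources. If \<open>d = 0\<close>, the state is
      \<open>(a, n)\<close> with \<open>a \<ge> 2\<close>, so processor 2 holds fewer than
      \<open>s + t - 1\<close> tasks and its type-2 share is larger. If \<open>d > 0\<close>, it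
      comes from \<open>E < D\<close>.\<close>
    have "E * (real n / (s + t - 1)) < D * (d / s) + E * (real b / t)"
    proof (cases "d = 0")
      case True
      then have bn: "b = n" by (simp add: d_def)
      then have "2 \<le> a" using True 3 ne by (auto simp: s_def)
      then have "t < s + t - 1" using True by (simp add: s_def)
      then have "real n / (s + t - 1) < real n / t"
        using 3 mn by (intro divide_strict_left_mono) auto
      then have "E * (real n / (s + t - 1)) < E * (real n / t)"
        using E by (intro mult_strict_left_mono) auto
      then show ?thesis using True bn by simp
    next
      case False
      then have d: "0 < d" using d0 by simp
      \<comment> \<open>Split the \<open>n\<close> type-2 tasks by their processor in the given
        state: \<open>n = d + b\<close>.\<close>
      have "real n / (s + t - 1) = d / (s + t - 1) + real b / (s + t - 1)"
        by (simp add: d_def add_divide_distrib[symmetric])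
      also have "\<dots> \<le> d / s + real b / t"
        using 3 d by (intro add_mono divide_left_mono) auto
      finally have "E * (real n / (s + t - 1)) \<le> E * (d / s) + E * (real b / t)"
        unfolding distrib_left[symmetric] using E by (intro mult_left_mono) auto
      moreover have "E * (d / s) < D * (d / s)"
        using 3 d E by (intro mult_strict_right_mono) auto
      ultimately show ?thesis by linarith
    qed
    moreover have "mean_rate u11 u21 (real a) (real n - real b) = u11 - D * (d / s)"
      using 3 by (simp add: mean_rate_eq D_def s_def d_def)
    moreover have "mean_rate u22 u12 (real b) (real m - real a) = u12 - E * (real b / t)"
      using 3 by (simp add: mean_rate_commute[of u22] mean_rate_eq E_def t_def add.commute)
    \<comment> \<open>In the state \<open>(1, n)\<close> processor 2 holds all but one of the
      \<open>s + t\<close> tasks.\<close>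
    moreover have "mean_rate u22 u12 (real n) (real m - 1) = u12 - E * (real n / (s + t - 1))"
      using mn by (simp add: mean_rate_commute[of u22] mean_rate_eq E_def st algebra_simps)
    ultimately show ?thesis by linarith
  qed
qed

lemma finite_states: "finite (states N1 N2)"
  by (simp add: states_def)

lemma max_state_iff:
  "max_state N1 N2 \<mu> S \<longleftrightarrow>
     S \<in> states N1 N2 \<and> (\<forall>T\<in>states N1 N2. throughput N1 N2 \<mu> T \<le> throughput N1 N2 \<mu> S)"
  by (auto simp: max_state_def is_arg_max_linorder)

text \<open>Strict comparison with every other state yields uniqueness, hence the equivalences in
  cases (iii) to (vi).\<close>

lemma max_state_unique:
  assumes "S0 \<in> states N1 N2"
    and "\<And>T. T \<in> states N1 N2 \<Longrightarrow> T \<noteq> S0 \<Longrightarrow> throughput N1 N2 \<mu> T < throughput N1 N2 \<mu> S0"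
  shows "max_state N1 N2 \<mu> S \<longleftrightarrow> S = S0"
  using assms unfolding max_state_iff by (metis leD order.refl order.strict_implies_order)

lemma max_state_exists: "\<exists>S. max_state N1 N2 \<mu> S"
proof -
  have "states N1 N2 \<noteq> {}" by (simp add: states_def)
  then obtain S where "S \<in> states N1 N2" "throughput N1 N2 \<mu> S = Max (throughput N1 N2 \<mu> ` states N1 N2)"
    by (metis Max_in finite_imageI finite_states image_iff image_is_empty)
  then show ?thesis
    unfolding max_state_iff using finite_states by (metis Max_ge finite_imageI imageI)
qed

lemma sys_throughput_le:
  assumes "policy N1 N2 p" and "max_state N1 N2 \<mu> S"
  shows "sys_throughput N1 N2 \<mu> p \<le> throughput N1 N2 \<mu> S"
proof -
  have "sys_throughput N1 N2 \<mu> p \<le> (\<Sum>T\<in>states N1 N2. p T * throughput N1 N2 \<mu> S)"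
    unfolding sys_throughput_def using assms
    by (intro sum_mono mult_left_mono) (auto simp: policy_def max_state_iff)
  also have "\<dots> = throughput N1 N2 \<mu> S"
    using assms by (simp add: policy_def flip: sum_distrib_right)
  finally show ?thesis .
qed

text \<open>The other probabilities are nonnegative and sum to 0, so they all vanish on
  \<open>states\<close>.\<close>

lemma sys_throughput_point_mass:
  assumes p: "policy N1 N2 p" and S: "S \<in> states N1 N2" and "p S = 1"
  shows "sys_throughput N1 N2 \<mu> p = throughput N1 N2 \<mu> S"
proof -
  have "(\<Sum>T\<in>states N1 N2 - {S}. p T) = 0"
    using p \<open>p S = 1\<close> sum.remove[OF finite_states S, of p] by (simp add: policy_def)
  then have "p T = 0" if "T \<in> states N1 N2 - {S}" for T
    using p that finite_states by (subst (asm) sum_nonneg_eq_0_iff) (auto simp: policy_def)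
  then have "(\<Sum>T\<in>states N1 N2 - {S}. p T * throughput N1 N2 \<mu> T) = 0"
    by (intro sum.neutral) simp
  then show ?thesis
    unfolding sys_throughput_def
    using \<open>p S = 1\<close> sum.remove[OF finite_states S, of "\<lambda>T. p T * throughput N1 N2 \<mu> T"] by simp
qed

lemma point_mass_optimal:
  assumes "max_state N1 N2 \<mu> S"
  shows "\<exists>p. policy N1 N2 p \<and> p S = 1"
    and "policy N1 N2 p \<Longrightarrow> p S = 1 \<Longrightarrow> optimal_policy N1 N2 \<mu> p"
proof -
  have S: "S \<in> states N1 N2" using assms by (simp add: max_state_iff)
  have "policy N1 N2 (\<lambda>T. if T = S then 1 else 0)"
    using S finite_states by (simp add: policy_def)
  then show "\<exists>p. policy N1 N2 p \<and> p S = 1" by force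
  show "optimal_policy N1 N2 \<mu> p" if "policy N1 N2 p" "p S = 1"
    using that sys_throughput_le[OF _ assms] sys_throughput_point_mass[OF _ S]
    by (auto simp: optimal_policy_def is_arg_max_linorder)
qed

text \<open>An occupied processor works at a constant rate whatever its mix of tasks. The two strict
  bounds exclude exactly \<open>(N1, 0)\<close> and \<open>(0, N2)\<close>, the states with an empty
  processor. This serves cases (i) and (ii).\<close>

lemma max_state_type_independent:
  assumes pos: "\<forall>i j. \<mu> $ i $ j > 0"
    and eq: "\<mu> $ 1 $ 1 = \<mu> $ 2 $ 1" "\<mu> $ 2 $ 2 = \<mu> $ 1 $ 2"
    and ab: "(a, b) \<in> states N1 N2" "- int N1 < int b - int a" "int b - int a < int N2"
  shows "max_state N1 N2 \<mu> (a, b)"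
proof -
  have "throughput N1 N2 \<mu> (a, b) = \<mu> $ 1 $ 1 + \<mu> $ 2 $ 2"
    using ab eq by (simp add: throughput_eq_mean_rates mean_rate_same)
  moreover have "throughput N1 N2 \<mu> (c, d) \<le> \<mu> $ 1 $ 1 + \<mu> $ 2 $ 2" if "(c, d) \<in> states N1 N2" for c d
    using that pos eq unfolding throughput_eq_mean_rates
    by (intro add_mono mean_rate_le) (auto simp: states_def less_imp_le)
  ultimately show ?thesis using ab by (auto simp: max_state_iff)
qed

text \<open>Each processor is fastest on its own type, and at \<open>(N1, N2)\<close> both reach
  their upper bounds at once. Cases (iii) and (iv) both supply the inequalities
  \<open>mu\<close>.\<close>

lemma max_state_symmetric:
  assumes "N1 \<ge> 1" "N2 \<ge> 1" and pos: "\<forall>i j. \<mu> $ i $ j > 0"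
    and mu: "\<mu> $ 1 $ 1 > \<mu> $ 2 $ 1" "\<mu> $ 2 $ 2 > \<mu> $ 1 $ 2"
  shows "max_state N1 N2 \<mu> S \<longleftrightarrow> S = (N1, N2)"
proof (rule max_state_unique)
  show "(N1, N2) \<in> states N1 N2" by (simp add: states_def)
  fix T assume T: "T \<in> states N1 N2" "T \<noteq> (N1, N2)"
  obtain a b where ab: "T = (a, b)" by (cases T)
  have le: "a \<le> N1" "b \<le> N2" using T ab by (auto simp: states_def)
  have le1: "mean_rate (\<mu> $ 1 $ 1) (\<mu> $ 2 $ 1) (real a) (real N2 - real b) \<le> \<mu> $ 1 $ 1"
    and le2: "mean_rate (\<mu> $ 2 $ 2) (\<mu> $ 1 $ 2) (real b) (real N1 - real a) \<le> \<mu> $ 2 $ 2"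
    using mu pos le by (auto intro!: mean_rate_le simp: less_imp_le)
  \<comment> \<open>Any other state puts a slower foreign task on processor 1
    (\<open>b < N2\<close>) or on processor 2 (\<open>a < N1\<close>), making that bound
    strict.\<close>
  consider "b < N2" | "a < N1" using T ab le by fastforce
  then have "throughput N1 N2 \<mu> T < \<mu> $ 1 $ 1 + \<mu> $ 2 $ 2"
  proof cases
    case 1
    then have "mean_rate (\<mu> $ 1 $ 1) (\<mu> $ 2 $ 1) (real a) (real N2 - real b) < \<mu> $ 1 $ 1"
      using mu by (intro mean_rate_less) auto
    then show ?thesis using le2 by (simp add: ab throughput_eq_mean_rates)
  next
    case 2
    then have "mean_rate (\<mu> $ 2 $ 2) (\<mu> $ 1 $ 2) (real b) (real N1 - real a) < \<mu> $ 2 $ 2"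
      using mu by (intro mean_rate_less) auto
    then show ?thesis using le1 by (simp add: ab throughput_eq_mean_rates)
  qed
  also have "\<dots> = throughput N1 N2 \<mu> (N1, N2)"
    using assms by (simp add: throughput_eq_mean_rates mean_rate_no_second)
  finally show "throughput N1 N2 \<mu> T < throughput N1 N2 \<mu> (N1, N2)" .
qed

lemma max_state_p1_biased:
  assumes N: "N1 \<ge> 1" "N2 \<ge> 1" and pos: "\<forall>i j. \<mu> $ i $ j > 0"
    and mu: "\<mu> $ 1 $ 1 > \<mu> $ 1 $ 2" "\<mu> $ 1 $ 2 > \<mu> $ 2 $ 2" "\<mu> $ 2 $ 2 > \<mu> $ 2 $ 1"
  shows "max_state N1 N2 \<mu> S \<longleftrightarrow> S = (1, N2)"
proof (rule max_state_unique)
  show "(1, N2) \<in> states N1 N2" using N by (simp add: states_def)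
  fix T assume T: "T \<in> states N1 N2" "T \<noteq> (1, N2)"
  obtain a b where ab: "T = (a, b)" by (cases T)
  show "throughput N1 N2 \<mu> T < throughput N1 N2 \<mu> (1, N2)"
    using p1_biased_strict_max[of "\<mu> $ 1 $ 2" "\<mu> $ 1 $ 1" "\<mu> $ 2 $ 2" "\<mu> $ 2 $ 1" N1 N2 a b] T N mu pos
    by (auto simp: ab throughput_eq_mean_rates mean_rate_no_second states_def)
qed

lemma max_state_p2_biased:
  assumes N: "N1 \<ge> 1" "N2 \<ge> 1" and pos: "\<forall>i j. \<mu> $ i $ j > 0"
    and mu: "\<mu> $ 2 $ 2 > \<mu> $ 2 $ 1" "\<mu> $ 2 $ 1 > \<mu> $ 1 $ 1" "\<mu> $ 1 $ 1 > \<mu> $ 1 $ 2"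
  shows "max_state N1 N2 \<mu> S \<longleftrightarrow> S = (N1, 1)"
proof (rule max_state_unique)
  show "(N1, 1) \<in> states N1 N2" using N by (simp add: states_def)
  fix T assume T: "T \<in> states N1 N2" "T \<noteq> (N1, 1)"
  obtain a b where ab: "T = (a, b)" by (cases T)
  show "throughput N1 N2 \<mu> T < throughput N1 N2 \<mu> (N1, 1)"
    \<comment> \<open>Swapping the indices 1 and 2 throughout, together with \<open>N1\<close>,
      \<open>N2\<close> and \<open>a\<close>, \<open>b\<close>, only interchanges the two summands
      of the throughput.\<close>
    using p1_biased_strict_max[of "\<mu> $ 2 $ 1" "\<mu> $ 2 $ 2" "\<mu> $ 1 $ 1" "\<mu> $ 1 $ 2" N2 N1 b a] T N mu pos
    by (auto simp: ab throughput_eq_mean_rates mean_rate_no_second states_def)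
qed

theorem lemma4:
  fixes N1 N2 :: nat and \<mu> :: "real^2^2"
  assumes "N1 \<ge> 1" and "N2 \<ge> 1" and "\<forall>i j. \<mu> $ i $ j > 0"
  shows "(\<exists>S. max_state N1 N2 \<mu> S)
    \<and> (\<forall>S. max_state N1 N2 \<mu> S \<longrightarrow>
         (\<exists>p. policy N1 N2 p \<and> p S = 1) \<and>
         (\<forall>p. policy N1 N2 p \<and> p S = 1 \<longrightarrow> optimal_policy N1 N2 \<mu> p))
    \<and> (\<mu> $ 1 $ 1 = \<mu> $ 2 $ 2 \<and> \<mu> $ 2 $ 2 = \<mu> $ 1 $ 2 \<and> \<mu> $ 1 $ 2 = \<mu> $ 2 $ 1 \<longrightarrow>
         (\<forall>(N11, N22)\<in>states N1 N2.
            - int N1 < int N22 - int N11 \<and> int N22 - int N11 < int N2 \<longrightarrow>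
            max_state N1 N2 \<mu> (N11, N22)))
    \<and> (\<mu> $ 1 $ 1 = \<mu> $ 2 $ 1 \<and> \<mu> $ 2 $ 2 = \<mu> $ 1 $ 2 \<and> \<mu> $ 1 $ 1 \<noteq> \<mu> $ 2 $ 2 \<longrightarrow>
         (\<forall>(N11, N22)\<in>states N1 N2.
            - int N1 < int N22 - int N11 \<and> int N22 - int N11 < int N2 \<longrightarrow>
            max_state N1 N2 \<mu> (N11, N22)))
    \<and> (\<mu> $ 1 $ 1 = \<mu> $ 2 $ 2 \<and> \<mu> $ 1 $ 2 = \<mu> $ 2 $ 1 \<and> \<mu> $ 1 $ 1 > \<mu> $ 1 $ 2 \<longrightarrow>
         (\<forall>S. max_state N1 N2 \<mu> S \<longleftrightarrow> S = (N1, N2)))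
    \<and> (\<mu> $ 1 $ 1 > \<mu> $ 1 $ 2 \<and> \<mu> $ 2 $ 1 < \<mu> $ 2 $ 2 \<and>
       \<mu> $ 1 $ 1 > \<mu> $ 2 $ 1 \<and> \<mu> $ 1 $ 2 < \<mu> $ 2 $ 2 \<longrightarrow>
         (\<forall>S. max_state N1 N2 \<mu> S \<longleftrightarrow> S = (N1, N2)))
    \<and> (\<mu> $ 1 $ 1 > \<mu> $ 1 $ 2 \<and> \<mu> $ 2 $ 1 < \<mu> $ 2 $ 2 \<and>
       \<mu> $ 1 $ 1 > \<mu> $ 2 $ 1 \<and> \<mu> $ 1 $ 2 > \<mu> $ 2 $ 2 \<longrightarrow>
         (\<forall>S. max_state N1 N2 \<mu> S \<longleftrightarrow> S = (1, N2)))
    \<and> (\<mu> $ 1 $ 1 > \<mu> $ 1 $ 2 \<and> \<mu> $ 2 $ 1 < \<mu> $ 2 $ 2 \<and>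
       \<mu> $ 1 $ 1 < \<mu> $ 2 $ 1 \<and> \<mu> $ 1 $ 2 < \<mu> $ 2 $ 2 \<longrightarrow>
         (\<forall>S. max_state N1 N2 \<mu> S \<longleftrightarrow> S = (N1, 1)))"
proof (intro conjI impI allI)
  show "\<exists>S. max_state N1 N2 \<mu> S" by (rule max_state_exists)
qed (use assms point_mass_optimal max_state_type_independent max_state_symmetric
      max_state_p1_biased max_state_p2_biased in auto)

end
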